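(* Let $n\in\mathbb{N}$ and $1<p<\infty$. Then $\|\cdot\|_p(\mathbb{Z}^n)\bmod 1$ is equidistributed, where $\|x\|_p=\left(\sum_{i=1}^n|x_i|^p\right)^{1/p}$ is the $\ell_p$-norm on $\mathbb{R}^n$.
   Context: Equidistribution: let $n\in\mathbb{N}$, let $\Gamma\subset\mathbb{R}^n$ be a discrete set and let $F:D\to\mathbb{R}$ with $D\subset\mathbb{R}^n$. Let $B_R(0)$ be the Euclidean ball of radius $R$ around the origin in $\mathbb{R}^n$, and let $\sigma_R^D$ be the normalized counting measure (uniform probability measure) on the points of $\Gamma$ in $B_R(0)\cap D$. Let $F\bmod 1:D\to\mathbb{R}/\mathbb{Z}$ be the composition of $F$ with the quotient map, and identify $\mathbb{R}/\mathbb{Z}$ with the unit circle $S^1$ via $t\mapsto e^{2\pi i t}$. One says that $F(\Gamma)\bmod 1$ is equidistributed if the push-forward measures $(F\bmod 1)_*\sigma_R^D$ converge weakly, as $R\to\infty$, to the Haar probability measure $\lambda$ on $S^1$. In this statement $D=\mathbb{R}^n$, $\Gamma=\mathbb{Z}^n$ and $F=\|\cdot\|_p$.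
   Formalization: The dimension is assumed to satisfy n ≥ 2: for n = 1 the norm is |x|, which takes only integer values on ℤ, so every push-forward is a point mass and the claim is false. *)

theory Defs
  imports "HOL-Probability.Probability"
begin

text \<open>
  The circle \<^term>\<open>S\<close>\<open>\<^sup>1\<close> is the unit sphere of \<^typ>\<open>complex\<close>. It carries its Borel sets as a
  subspace, so that measures on it live on \<open>circle_borel\<close>.
\<close>

abbreviation circle :: "complex set" where
  "circle \<equiv> sphere 0 1"

abbreviation circle_borel :: "complex measure" where
  "circle_borel \<equiv> restrict_space borel circle"

text \<open>The identification of \<open>\<real>/\<int>\<close> with the circle, precomposed with \<open>\<real> \<rightarrow> \<real>/\<int>\<close>.\<close>

definition mod_one :: "real \<Rightarrow> complex" where
  "mod_one t = cis (2 * pi * t)"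

text \<open>
  Haar probability measure on the circle, as the image of Lebesgue measure on \<open>[0,1)\<close>;
  \<open>prob_space_circle_haar\<close> and \<open>circle_haar_rotation_invariant\<close> below are the properties that
  characterize it.
\<close>

definition circle_haar :: "complex measure" where
  "circle_haar = distr (uniform_measure lborel {0..<1}) circle_borel mod_one"

lemma mod_one_in_circle: "mod_one t \<in> circle"
  by (simp add: mod_one_def)

lemma mod_one_measurable [measurable]: "mod_one \<in> borel \<rightarrow>\<^sub>M circle_borel"
proof (rule measurable_restrict_space2)
  show "mod_one \<in> borel \<rightarrow>\<^sub>M borel"
    unfolding mod_one_def by (intro borel_measurable_continuous_onI continuous_intros)
qed (simp add: mod_one_def)

lemma mod_one_add: "mod_one (s + t) = mod_one s * mod_one t"
  by (simp add: mod_one_def cis_mult distrib_left)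

lemma mod_one_add_int: "mod_one (t + of_int k) = mod_one t"
proof -
  have "mod_one (of_int k) = 1"
    using cis_multiple_2pi[of "of_int k"] by (simp add: mod_one_def)
  then show ?thesis by (simp add: mod_one_add)
qed

lemma prob_space_circle_haar: "prob_space circle_haar"
proof -
  interpret prob_space "uniform_measure lborel {0..<1::real}"
    by (rule prob_space_uniform_measure) auto
  show ?thesis
    unfolding circle_haar_def by (rule prob_space_distr) simp
qed

lemma mod_one_surj:
  assumes "w \<in> circle"
  obtains s where "0 \<le> s" "s < 1" "w = mod_one s"
proof -
  have "w = mod_one (frac (Arg w / (2 * pi)))"
  proof -
    have "w = cis (Arg w)"
      using assms cis_Arg[of w] by (cases "w = 0") (auto simp: sgn_div_norm)
    also have "\<dots> = mod_one (Arg w / (2 * pi))"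
      by (simp add: mod_one_def)
    also have "\<dots> = mod_one (frac (Arg w / (2 * pi)))"
      using mod_one_add_int[of "frac (Arg w / (2 * pi))" "\<lfloor>Arg w / (2 * pi)\<rfloor>"]
      by (simp add: frac_def)
    finally show ?thesis .
  qed
  then show thesis
    using that[of "frac (Arg w / (2 * pi))"] by (simp add: frac_lt_1)
qed

lemma emeasure_circle_haar:
  assumes "A \<in> sets circle_borel"
  shows "emeasure circle_haar A = emeasure lborel ({0..<1} \<inter> mod_one -` A)"
proof -
  have m: "mod_one \<in> uniform_measure lborel {0..<1} \<rightarrow>\<^sub>M circle_borel"
    by simp
  have P: "mod_one -` A \<in> sets borel"
    using measurable_sets[OF mod_one_measurable assms] by simp
  show ?thesis
    unfolding circle_haar_def emeasure_distr[OF m assms]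
    using P by (simp add: divide_ennreal_def)
qed

lemma emeasure_lborel_translate:
  fixes c :: real
  assumes "S \<in> sets borel"
  shows "emeasure lborel ((+) c -` S) = emeasure lborel S"
proof -
  have "emeasure lborel S = emeasure (distr lborel borel ((+) c)) S"
    by (simp add: lborel_distr_plus)
  also have "\<dots> = emeasure lborel ((+) c -` S)"
    using assms by (subst emeasure_distr) auto
  finally show ?thesis by simp
qed

lemma circle_haar_rotation_invariant:
  assumes "w \<in> circle"
  shows "distr circle_haar circle_borel ((*) w) = circle_haar"
proof (rule measure_eqI)
  show "sets (distr circle_haar circle_borel ((*) w)) = sets circle_haar"
    by (simp add: circle_haar_def)
next
  fix A
  assume "A \<in> sets (distr circle_haar circle_borel ((*) w))"
  then have A: "A \<in> sets circle_borel"
    by simp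
  obtain s where s: "0 \<le> s" "s < 1" and w: "w = mod_one s"
    using assms by (rule mod_one_surj)
  have rot: "(*) w \<in> circle_borel \<rightarrow>\<^sub>M circle_borel"
    by (rule measurable_restrict_space2)
       (use assms in \<open>auto simp: space_restrict_space norm_mult intro!: measurable_restrict_space1\<close>)
  have rot': "(*) w \<in> circle_haar \<rightarrow>\<^sub>M circle_borel"
    using rot by (simp add: circle_haar_def)
  define P where "P = mod_one -` A"
  have P [measurable]: "P \<in> sets borel"
    unfolding P_def using measurable_sets[OF mod_one_measurable A] by simp
  have per: "t + 1 \<in> P \<longleftrightarrow> t \<in> P" for t
    using mod_one_add_int[of t 1] by (simp add: P_def)
  have space_haar: "space circle_haar = circle"
    by (simp add: circle_haar_def space_restrict_space)
  have "emeasure (distr circle_haar circle_borel ((*) w)) A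
        = emeasure circle_haar ((*) w -` A \<inter> circle)"
    by (subst emeasure_distr[OF rot' A]) (simp add: space_haar)
  also have "\<dots> = emeasure lborel ({0..<1} \<inter> mod_one -` ((*) w -` A \<inter> circle))"
    by (rule emeasure_circle_haar)
       (use measurable_sets[OF rot A] in \<open>simp add: space_restrict_space\<close>)
  also have "{0..<1} \<inter> mod_one -` ((*) w -` A \<inter> circle) = (+) s -` ({s..<1 + s} \<inter> P)"
    using mod_one_in_circle by (auto simp: P_def w mod_one_add simp del: mem_sphere)
  also have "emeasure lborel \<dots> = emeasure lborel ({s..<1 + s} \<inter> P)"
    by (rule emeasure_lborel_translate) simp
  also have "{s..<1 + s} \<inter> P = ({s..<1} \<inter> P) \<union> ({1..<1 + s} \<inter> P)"
    using s by auto
  also have "emeasure lborel \<dots> = emeasure lborel ({s..<1} \<inter> P) + emeasure lborel ({1..<1 + s} \<inter> P)"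
    by (rule plus_emeasure[symmetric]) auto
  also have "emeasure lborel ({1..<1 + s} \<inter> P) = emeasure lborel ((+) 1 -` ({1..<1 + s} \<inter> P))"
    by (rule emeasure_lborel_translate[symmetric]) simp
  also have "(+) 1 -` ({1..<1 + s} \<inter> P) = {0..<s} \<inter> P"
    by (auto simp: per add.commute[of 1])
  also have "emeasure lborel ({s..<1} \<inter> P) + emeasure lborel ({0..<s} \<inter> P)
             = emeasure lborel (({s..<1} \<inter> P) \<union> ({0..<s} \<inter> P))"
    by (rule plus_emeasure) auto
  also have "({s..<1} \<inter> P) \<union> ({0..<s} \<inter> P) = {0..<1} \<inter> P"
    using s by auto
  also have "emeasure lborel \<dots> = emeasure circle_haar A"
    using A by (simp add: emeasure_circle_haar P_def)
  finally show "emeasure (distr circle_haar circle_borel ((*) w)) A = emeasure circle_haar A" .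
qed

text \<open>
  The circle is compact, so its bounded continuous functions are all its continuous ones. The
  values of \<open>f\<close> off the circle do not matter when the measures live on \<open>circle_borel\<close>.
\<close>

definition weak_conv_circle :: "('i \<Rightarrow> complex measure) \<Rightarrow> complex measure \<Rightarrow> 'i filter \<Rightarrow> bool" where
  "weak_conv_circle M N G \<longleftrightarrow>
     (\<forall>f :: complex \<Rightarrow> real. continuous_on circle f \<longrightarrow>
        ((\<lambda>i. \<integral>z. f z \<partial>M i) \<longlongrightarrow> (\<integral>z. f z \<partial>N)) G)"

text \<open>
  The normalized counting measure \<open>\<sigma>\<close> on the points of \<open>\<Gamma>\<close> in \<open>ball 0 R \<inter> D\<close>. It is a probability
  measure if there are finitely many such points and at least one; this holds for the integer
  lattice with \<open>D = UNIV\<close> and \<open>R > 0\<close>.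
\<close>

definition counting_ball :: "'a::real_normed_vector set \<Rightarrow> 'a set \<Rightarrow> real \<Rightarrow> 'a measure" where
  "counting_ball \<Gamma> D R = uniform_count_measure (\<Gamma> \<inter> (ball 0 R \<inter> D))"

definition equidistributed_mod_one ::
    "(real ^ 'n) set \<Rightarrow> (real ^ 'n) set \<Rightarrow> (real ^ 'n \<Rightarrow> real) \<Rightarrow> bool" where
  "equidistributed_mod_one \<Gamma> D F \<longleftrightarrow>
     weak_conv_circle (\<lambda>R. distr (counting_ball \<Gamma> D R) circle_borel (mod_one \<circ> F))
       circle_haar at_top"

definition integer_lattice :: "(real ^ 'n) set" where
  "integer_lattice = {x. \<forall>i. x $ i \<in> \<int>}"

definition lp_norm :: "real \<Rightarrow> real ^ 'n \<Rightarrow> real" where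
  "lp_norm p x = (\<Sum>i\<in>UNIV. \<bar>x $ i\<bar> powr p) powr (1 / p)"

end

theory Submission
  imports Defs
begin

text \<open>
  Write \<open>N\<close> for the norm, \<open>n\<close> for the dimension and \<open>\<Lambda>\<^sub>R\<close> for the set of lattice points in the open
  ball of radius \<open>R\<close>. By Weyl's criterion (\<open>weyl_criterion_circle\<close>) it suffices that for every
  integer \<open>k \<noteq> 0\<close> the exponential sum of \<open>exp (2 \<pi> i k N x)\<close> over \<open>\<Lambda>\<^sub>R\<close> is \<open>o(R\<^sup>n)\<close>, because \<open>\<Lambda>\<^sub>R\<close>
  itself has asymptotically \<open>vol (ball 0 1) R\<^sup>n\<close> elements (\<open>card_lattice_ball_tendsto\<close>).

  The reason for cancellation is that far from the origin the norm is almost affine along short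
  segments: for fixed \<open>h\<close>, a point \<open>x\<close> in direction \<open>y\<close> satisfies \<open>N (x + h e\<^sub>i) - N x \<approx> h \<theta> y\<close>, where
  \<open>\<theta>\<close> is the \<open>i\<close>-th partial derivative of \<open>N\<close>, which is homogeneous of degree 0
  (\<open>lp_norm_increment_tendsto\<close>). So along \<open>x, x + e\<^sub>i, x + 2 e\<^sub>i, \<dots>\<close> the phases form almost a rotation
  orbit with angle \<open>k \<theta> y\<close>, and the average of \<open>H\<close> consecutive terms is small for large \<open>H\<close> unless
  \<open>k \<theta> y\<close> is an integer. For \<open>p > 1\<close> the derivative \<open>\<theta>\<close> is injective on every line parallel to \<open>e\<^sub>i\<close>
  on which another coordinate is a nonzero constant (\<open>lp_slope_inj_on_line\<close>); almost every
  line is of this kind as \<open>n \<ge> 2\<close>. Hence each level set of \<open>\<theta>\<close> is null, and so is the set of resonant \<open>y\<close>.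

  To make this precise without counting lattice points near the boundary or near the resonant set,
  the sum divided by \<open>R\<^sup>n\<close> is written as a Lebesgue integral of the summand evaluated at the
  coordinatewise floor of \<open>R y\<close> (\<open>integral_lattice_floor\<close>). Translating \<open>y\<close> by \<open>(h / R) e\<^sub>i\<close> leaves the
  integral unchanged and moves the lattice point by \<open>h e\<^sub>i\<close>. Averaging over \<open>h < H\<close>, taking absolute
  values inside, and applying dominated convergence as \<open>R \<rightarrow> \<infinity>\<close> bounds the upper limit by the
  integral of \<open>\<bar>H\<^sup>-\<^sup>1 \<Sum>h<H. exp (2 \<pi> i k h \<theta> y)\<bar>\<close> over the unit ball; a second application of dominated
  convergence, as \<open>H \<rightarrow> \<infinity>\<close>, shows that this bound tends to 0.
\<close>

section \<open>Weyl's criterion on the circle\<close>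

text \<open>
  Real trigonometric polynomials. Only the values on the circle are prescribed, since the reduction
  of products of monomials uses that the conjugate is the inverse there.
\<close>

inductive trig_poly :: "(complex \<Rightarrow> real) \<Rightarrow> bool" where
  monomial: "(\<And>z. z \<in> circle \<Longrightarrow> f z = Re (c * z powi k)) \<Longrightarrow> trig_poly f"
| add: "trig_poly f \<Longrightarrow> trig_poly g \<Longrightarrow> (\<And>z. z \<in> circle \<Longrightarrow> h z = f z + g z) \<Longrightarrow> trig_poly h"

lemma continuous_on_powi_circle: "continuous_on circle (\<lambda>z. z powi k)"
  by (intro continuous_intros) auto

lemma trig_poly_continuous: "trig_poly f \<Longrightarrow> continuous_on circle f"
proof (induction rule: trig_poly.induct)
  case (monomial f c k)
  have "continuous_on circle (\<lambda>z. Re (c * z powi k))"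
    by (intro continuous_intros continuous_on_powi_circle)
  then show ?case
    by (rule continuous_on_eq) (use monomial in auto)
next
  case (add f g h)
  then have "continuous_on circle (\<lambda>z. f z + g z)"
    by (intro continuous_intros)
  then show ?case
    by (rule continuous_on_eq) (use add in auto)
qed

text \<open>
  The product formula \<open>Re a * Re b = (Re (a * b) + Re (a * cnj b)) / 2\<close> writes a product of two
  monomials as a sum of two.
\<close>

lemma trig_poly_mult_monomial:
  assumes "trig_poly f"
  shows "(\<And>z. z \<in> circle \<Longrightarrow> h z = f z * Re (d * z powi l)) \<Longrightarrow> trig_poly h"
  using assms
proof (induction arbitrary: h rule: trig_poly.induct)
  case (monomial f c k)
  show ?case
  proof (rule trig_poly.add)
    show "trig_poly (\<lambda>z. Re (c * d / 2 * z powi (k + l)))"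
      by (rule trig_poly.monomial) (rule refl)
    show "trig_poly (\<lambda>z. Re (c * cnj d / 2 * z powi (k - l)))"
      by (rule trig_poly.monomial) (rule refl)
    fix z :: complex assume z: "z \<in> circle"
    then have nz: "z \<noteq> 0" by auto
    have "z * cnj z = 1"
      using z by (simp add: complex_norm_square[symmetric])
    then have "cnj z = inverse z"
      by (metis inverse_unique)
    then have cnj: "cnj (z powi l) = z powi (- l)"
      by (simp add: power_int_minus power_int_inverse)
    have *: "Re a * Re b = Re (a * b / 2) + Re (a * cnj b / 2)" for a b
      by (simp add: field_simps)
    have "h z = Re (c * z powi k) * Re (d * z powi l)"
      using monomial z by simp
    also have "\<dots> = Re (c * z powi k * (d * z powi l) / 2) + Re (c * z powi k * cnj (d * z powi l) / 2)"
      by (rule *)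
    also have "c * z powi k * (d * z powi l) / 2 = c * d / 2 * z powi (k + l)"
      using nz by (simp add: power_int_add)
    also have "c * z powi k * cnj (d * z powi l) / 2 = c * cnj d / 2 * (z powi k * z powi (- l))"
      by (simp only: complex_cnj_mult cnj) simp
    also have "z powi k * z powi (- l) = z powi (k - l)"
      using nz by (simp flip: power_int_add)
    finally show "h z = Re (c * d / 2 * z powi (k + l)) + Re (c * cnj d / 2 * z powi (k - l))" .
  qed
next
  case (add f g f')
  show ?case
  proof (rule trig_poly.add)
    show "trig_poly (\<lambda>z. f z * Re (d * z powi l))"
      by (rule add.IH) simp
    show "trig_poly (\<lambda>z. g z * Re (d * z powi l))"
      by (rule add.IH) simp
  qed (simp add: add distrib_right)
qed

lemma trig_poly_mult:
  assumes "trig_poly g" "trig_poly f"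
  shows "trig_poly (\<lambda>z. f z * g z)"
proof -
  have *: "(\<And>z. z \<in> circle \<Longrightarrow> h z = f z * g z) \<Longrightarrow> trig_poly h" for h
    using assms(1)
  proof (induction arbitrary: h rule: trig_poly.induct)
    case (monomial g c k)
    show ?case
      by (rule trig_poly_mult_monomial[OF assms(2), of _ c k]) (simp only: monomial)
  next
    case (add g g' g'')
    show ?case
    proof (rule trig_poly.add)
      show "trig_poly (\<lambda>z. f z * g z)"
        by (rule add.IH) simp
      show "trig_poly (\<lambda>z. f z * g' z)"
        by (rule add.IH) simp
    qed (simp add: add distrib_left)
  qed
  show ?thesis
    by (rule *) (rule refl)
qed

text \<open>
  Stone--Weierstrass: the real and imaginary parts are trigonometric polynomials that together
  separate points.
\<close>

lemma trig_poly_dense: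
  assumes "continuous_on circle f" "0 < e"
  obtains g where "trig_poly g" "\<And>z. z \<in> circle \<Longrightarrow> \<bar>f z - g z\<bar> < e"
proof -
  have "\<exists>g. trig_poly g \<and> (\<forall>z\<in>circle. \<bar>f z - g z\<bar> < e)"
  proof (rule Stone_Weierstrass_HOL)
    show "trig_poly (\<lambda>x. c)" for c
      by (rule trig_poly.monomial[of _ "of_real c" 0]) simp
    show "trig_poly (\<lambda>x. f x + g x)" if "trig_poly f \<and> trig_poly g" for f g
      using that by (auto intro: trig_poly.add)
    show "\<exists>f. trig_poly f \<and> f x \<noteq> f y" if "x \<in> circle \<and> y \<in> circle \<and> x \<noteq> y" for x y
    proof -
      have "trig_poly Re"
        by (rule trig_poly.monomial[of _ 1 1]) simp
      moreover have "trig_poly Im"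
        by (rule trig_poly.monomial[of _ "- \<i>" 1]) simp
      ultimately show ?thesis
        using that complex_eq_iff by blast
    qed
  qed (use assms trig_poly_continuous trig_poly_mult in auto)
  then show thesis using that by blast
qed

lemma measurable_circle_continuous:
  assumes "continuous_on circle f" "sets M = sets circle_borel"
  shows "f \<in> borel_measurable M"
  using borel_measurable_continuous_on_restrict[OF assms(1)] measurable_cong_sets[OF assms(2) refl]
  by blast

lemma integrable_circle_continuous:
  fixes f :: "complex \<Rightarrow> 'b::{banach, second_countable_topology}"
  assumes "prob_space M" "sets M = sets circle_borel" "continuous_on circle f"
  shows "integrable M f"
proof -
  interpret prob_space M by fact
  have space: "space M = circle"
    using sets_eq_imp_space_eq[OF assms(2)] by (simp add: space_restrict_space)
  have "bounded (f ` circle)"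
    by (rule compact_imp_bounded[OF compact_continuous_image[OF assms(3) compact_sphere]])
  then obtain B where B: "\<And>y. y \<in> f ` circle \<Longrightarrow> norm y \<le> B"
    by (auto simp only: bounded_iff)
  show ?thesis
  proof (rule integrable_const_bound)
    show "AE z in M. norm (f z) \<le> B"
      by (rule AE_I2, rule B, rule imageI) (simp only: space)
    show "f \<in> borel_measurable M"
      by (rule measurable_circle_continuous[OF assms(3,2)])
  qed
qed

text \<open>
  Rotating by a point \<open>w\<close> with \<open>w powi k = -1\<close> shows that the integral equals its own negative.
\<close>

lemma integral_circle_haar_powi:
  fixes k :: int
  assumes "k \<noteq> 0"
  shows "(\<integral>z. z powi k \<partial>circle_haar) = 0"
proof -
  \<comment> \<open>With this argument \<open>w powi k\<close> is half a turn.\<close>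
  define w where "w = mod_one (1 / (2 * of_int k))"
  have w: "w \<in> circle"
    using mod_one_in_circle by (simp add: w_def)
  have wk: "w powi k = -1"
    using assms by (simp add: w_def mod_one_def cis_power_int)
  have "(*) w \<in> circle_haar \<rightarrow>\<^sub>M circle_borel"
    unfolding circle_haar_def measurable_distr_eq1 using w
    by (intro measurable_restrict_space2)
       (auto simp: space_restrict_space norm_mult intro!: measurable_restrict_space1)
  then have "(\<integral>z. z powi k \<partial>distr circle_haar circle_borel ((*) w)) =
      (\<integral>z. (w * z) powi k \<partial>circle_haar)"
    by (intro integral_distr measurable_circle_continuous continuous_on_powi_circle) simp_all
  also have "\<dots> = (\<integral>z. - (z powi k) \<partial>circle_haar)"
    by (simp add: power_int_mult_distrib wk)
  finally have "(\<integral>z. z powi k \<partial>circle_haar) = - (\<integral>z. z powi k \<partial>circle_haar)"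
    by (simp add: circle_haar_rotation_invariant[OF w])
  then show ?thesis by simp
qed

text \<open>
  The hypothesis gives convergence of the integrals of trigonometric polynomials; these are
  uniformly dense in the continuous functions, and integration against a probability measure is
  1-Lipschitz for the uniform distance.
\<close>

lemma weyl_criterion_circle:
  fixes M :: "'i \<Rightarrow> complex measure"
  assumes prob: "\<forall>\<^sub>F i in G. prob_space (M i)"
    and sets: "\<And>i. sets (M i) = sets circle_borel"
    and powers: "\<And>k::int. k \<noteq> 0 \<Longrightarrow> ((\<lambda>i. \<integral>z. z powi k \<partial>M i) \<longlongrightarrow> 0) G"
  shows "weak_conv_circle M circle_haar G"
proof -
  have haar_sets: "sets circle_haar = sets circle_borel"
    by (simp add: circle_haar_def)
  have space: "space N = circle" if "sets N = sets circle_borel" for N :: "complex measure"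
    using sets_eq_imp_space_eq[OF that] by (simp add: space_restrict_space)
  note haar = prob_space_circle_haar haar_sets
  have powers_haar: "((\<lambda>i. \<integral>z. z powi k \<partial>M i) \<longlongrightarrow> (\<integral>z. z powi k \<partial>circle_haar)) G" for k :: int
  proof (cases "k = 0")
    case True
    have one: "(\<integral>z. (1::complex) \<partial>N) = 1" if "prob_space N" for N :: "complex measure"
      using prob_space.prob_space[OF that] by simp
    have "\<forall>\<^sub>F i in G. (\<integral>z. (1::complex) \<partial>M i) = 1"
      using prob one by (rule eventually_mono)
    then show ?thesis
      using True one[OF haar(1)] by (simp add: tendsto_eventually del: lebesgue_integral_const)
  qed (simp add: powers integral_circle_haar_powi)
  have trig: "((\<lambda>i. \<integral>z. g z \<partial>M i) \<longlongrightarrow> (\<integral>z. g z \<partial>circle_haar)) G" if "trig_poly g" for g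
    using that
  proof (induction rule: trig_poly.induct)
    case (monomial f c k)
    have int: "(\<integral>z. f z \<partial>N) = Re (c * (\<integral>z. z powi k \<partial>N))"
      if N: "prob_space N" "sets N = sets circle_borel" for N
    proof -
      have "integrable N (\<lambda>z. z powi k)"
        by (rule integrable_circle_continuous[OF N continuous_on_powi_circle])
      then have "Re (c * (\<integral>z. z powi k \<partial>N)) = (\<integral>z. Re (c * z powi k) \<partial>N)"
        by (subst integral_Re) simp_all
      also have "\<dots> = (\<integral>z. f z \<partial>N)"
        by (rule Bochner_Integration.integral_cong) (simp_all add: space[OF N(2)] monomial)
      finally show ?thesis ..
    qed
    have "((\<lambda>i. Re (c * (\<integral>z. z powi k \<partial>M i))) \<longlongrightarrow> Re (c * (\<integral>z. z powi k \<partial>circle_haar))) G"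
      by (intro tendsto_intros powers_haar)
    then show ?case
      unfolding int[OF haar]
      by (rule Lim_transform_eventually) (use prob in \<open>auto elim!: eventually_mono simp: int sets\<close>)
  next
    case (add f g h)
    have int: "(\<integral>z. h z \<partial>N) = (\<integral>z. f z \<partial>N) + (\<integral>z. g z \<partial>N)"
      if N: "prob_space N" "sets N = sets circle_borel" for N
    proof -
      have "(\<integral>z. h z \<partial>N) = (\<integral>z. f z + g z \<partial>N)"
        by (rule Bochner_Integration.integral_cong) (simp_all add: space[OF N(2)] add)
      also have "\<dots> = (\<integral>z. f z \<partial>N) + (\<integral>z. g z \<partial>N)"
        using add by (intro Bochner_Integration.integral_add integrable_circle_continuous[OF N]
            trig_poly_continuous)
      finally show ?thesis .
    qed
    have "((\<lambda>i. (\<integral>z. f z \<partial>M i) + (\<integral>z. g z \<partial>M i)) \<longlongrightarrow>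
        (\<integral>z. f z \<partial>circle_haar) + (\<integral>z. g z \<partial>circle_haar)) G"
      by (intro tendsto_intros add.IH)
    then show ?case
      unfolding int[OF haar]
      by (rule Lim_transform_eventually) (use prob in \<open>auto elim!: eventually_mono simp: int sets\<close>)
  qed
  show ?thesis
    unfolding weak_conv_circle_def
  proof (intro allI impI tendstoI)
    fix f :: "complex \<Rightarrow> real" and e :: real
    assume f: "continuous_on circle f" and e: "0 < e"
    obtain g where g: "trig_poly g" "\<And>z. z \<in> circle \<Longrightarrow> \<bar>f z - g z\<bar> < e / 3"
      using trig_poly_dense[OF f, of "e / 3"] e by auto
    have close: "\<bar>(\<integral>z. f z \<partial>N) - (\<integral>z. g z \<partial>N)\<bar> \<le> e / 3"
      if N: "prob_space N" "sets N = sets circle_borel" for N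
    proof -
      interpret prob_space N by fact
      have int: "integrable N f" "integrable N g"
        using N f g by (auto intro!: integrable_circle_continuous trig_poly_continuous)
      have "\<bar>(\<integral>z. f z \<partial>N) - (\<integral>z. g z \<partial>N)\<bar> = \<bar>\<integral>z. f z - g z \<partial>N\<bar>"
        using int by simp
      also have "\<dots> \<le> (\<integral>z. \<bar>f z - g z\<bar> \<partial>N)"
        by (rule integral_abs_bound)
      also have "\<dots> \<le> (\<integral>z. e / 3 \<partial>N)"
        using int g(2) by (intro integral_mono) (auto simp: space[OF N(2)] less_imp_le)
      also have "\<dots> = e / 3"
        by (simp add: prob_space)
      finally show ?thesis .
    qed
    have "\<forall>\<^sub>F i in G. dist (\<integral>z. g z \<partial>M i) (\<integral>z. g z \<partial>circle_haar) < e / 3"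
      using trig[OF g(1)] e by (intro tendstoD) auto
    with prob show "\<forall>\<^sub>F i in G. dist (\<integral>z. f z \<partial>M i) (\<integral>z. f z \<partial>circle_haar) < e"
    proof eventually_elim
      case (elim i)
      show ?case
        using close[OF elim(1) sets] close[OF haar] elim(2) unfolding dist_real_def by linarith
    qed
  qed
qed

section \<open>Lattice sums as integrals\<close>

text \<open>
  The lattice point attached to \<open>y\<close> at scale \<open>R\<close>. Its fibres are half-open cubes of side \<open>1 / R\<close> that
  partition space, which turns sums over lattice points into integrals over \<open>y\<close>.
\<close>

definition lattice_floor :: "real \<Rightarrow> real ^ 'n \<Rightarrow> real ^ 'n" where
  "lattice_floor R y = (\<chi> i. of_int \<lfloor>R * y $ i\<rfloor>)"

lemma measurable_vec_nth [measurable]: "(\<lambda>y :: real ^ 'n. y $ i) \<in> borel_measurable borel"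
  by (intro borel_measurable_continuous_onI continuous_intros)

lemma measurable_lattice_floor [measurable]: "lattice_floor R \<in> borel_measurable borel"
proof (subst borel_measurable_euclidean_space, rule ballI)
  fix b :: "real ^ 'n" assume "b \<in> Basis"
  then obtain i where "b = axis i 1"
    by (auto simp: Basis_vec_def)
  then have "(\<lambda>y. lattice_floor R y \<bullet> b) = (\<lambda>y. of_int \<lfloor>R * y $ i\<rfloor>)"
    by (simp add: lattice_floor_def inner_axis)
  then show "(\<lambda>y. lattice_floor R y \<bullet> b) \<in> borel_measurable borel"
    by simp
qed

lemma lattice_floor_in_lattice: "lattice_floor R y \<in> integer_lattice"
  by (simp add: lattice_floor_def integer_lattice_def)

lemma finite_lattice_ball: "finite (integer_lattice \<inter> ball (0 :: real ^ 'n) R)"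
proof (rule finite_subset)
  define I where "I = real_of_int ` {- \<lceil>R\<rceil>..\<lceil>R\<rceil>}"
  show "integer_lattice \<inter> ball (0 :: real ^ 'n) R \<subseteq> vec_lambda ` (UNIV \<rightarrow>\<^sub>E I)"
  proof
    fix x :: "real ^ 'n" assume x: "x \<in> integer_lattice \<inter> ball 0 R"
    have "x $ i \<in> I" for i
    proof -
      obtain k where k: "x $ i = of_int k"
        using x by (auto simp: integer_lattice_def elim: Ints_cases)
      have "\<bar>x $ i\<bar> \<le> R"
        using x component_le_norm_cart[of x i] by simp
      then have "k \<in> {- \<lceil>R\<rceil>..\<lceil>R\<rceil>}"
        unfolding k by (auto simp: abs_le_iff) linarith+
      then show ?thesis
        using k by (auto simp: I_def)
    qed
    then show "x \<in> vec_lambda ` (UNIV \<rightarrow>\<^sub>E I)"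
      by (intro image_eqI[of _ _ "vec_nth x"]) auto
  qed
  show "finite (vec_lambda ` (UNIV \<rightarrow>\<^sub>E I) :: (real ^ 'n) set)"
    unfolding I_def by (intro finite_imageI finite_PiE) auto
qed

text \<open>
  A fibre lies between the open and the closed cube with the same corners.
\<close>

lemma emeasure_lattice_floor_fibre:
  fixes x :: "real ^ 'n"
  assumes "0 < R" "x \<in> integer_lattice"
  shows "emeasure lborel {y. lattice_floor R y = x} = ennreal (1 / R ^ CARD('n))"
proof -
  define a where "a = (\<chi> i. x $ i / R)"
  define b where "b = (\<chi> i. (x $ i + 1) / R)"
  have ab: "b $ i - a $ i = 1 / R" "a $ i < b $ i" for i
    using assms by (simp_all add: a_def b_def field_simps)
  have Q: "lattice_floor R y = x \<longleftrightarrow> (\<forall>i. a $ i \<le> y $ i \<and> y $ i < b $ i)" for y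
  proof -
    have "of_int \<lfloor>R * y $ i\<rfloor> = x $ i \<longleftrightarrow> a $ i \<le> y $ i \<and> y $ i < b $ i" for i
    proof -
      obtain k where k: "x $ i = of_int k"
        using assms by (auto simp: integer_lattice_def elim: Ints_cases)
      show ?thesis
        using assms by (simp add: k a_def b_def floor_eq_iff field_simps)
    qed
    then show ?thesis
      by (simp add: lattice_floor_def vec_eq_iff)
  qed
  have ne: "\<forall>b'\<in>Basis. a \<bullet> b' \<le> b \<bullet> b'"
    using ab(2) by (auto simp: Basis_vec_def inner_axis less_imp_le)
  have "cbox a b \<noteq> {}"
    using ab(2) by (auto simp: interval_eq_empty_cart) (metis order.asym)
  then have content: "measure lborel (cbox a b) = 1 / R ^ CARD('n)"
    using content_cbox_cart[of a b] by (simp add: ab power_one_over)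
  have cbox: "emeasure lborel (cbox a b) = ennreal (1 / R ^ CARD('n))"
    using emeasure_eq_ennreal_measure[of lborel "cbox a b"] emeasure_lborel_cbox_finite[of a b]
    by (simp add: content)
  have box: "emeasure lborel (box a b) = emeasure lborel (cbox a b)"
    using ne by (simp add: emeasure_lborel_box_eq emeasure_lborel_cbox_eq)
  have "box a b \<subseteq> {y. lattice_floor R y = x}" "{y. lattice_floor R y = x} \<subseteq> cbox a b"
    by (auto simp: Q mem_box_cart less_imp_le)
  moreover have "{y. lattice_floor R y = x} \<in> sets lborel"
    by measurable
  ultimately show ?thesis
    using emeasure_mono[of "box a b" _ lborel] emeasure_mono[of _ "cbox a b" lborel] box cbox
    by (metis antisym sets_lborel borel_closed closed_cbox)
qed

lemma integral_lattice_floor: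
  fixes u :: "real ^ 'n \<Rightarrow> 'b :: {banach, second_countable_topology}"
  assumes "0 < R"
  shows "(\<integral>y. indicator (ball 0 R) (lattice_floor R y) *\<^sub>R u (lattice_floor R y) \<partial>lborel) =
    (\<Sum>x\<in>integer_lattice \<inter> ball 0 R. u x) /\<^sub>R R ^ CARD('n)"
proof -
  let ?A = "integer_lattice \<inter> ball (0 :: real ^ 'n) R"
  let ?Q = "\<lambda>x. {y. lattice_floor R y = x}"
  have Q: "?Q x \<in> sets lborel" for x :: "real ^ 'n"
    by measurable
  have m: "emeasure lborel (?Q x) = ennreal (1 / R ^ CARD('n))" if "x \<in> ?A" for x
    using that assms by (intro emeasure_lattice_floor_fibre) auto
  have "indicator (ball 0 R) (lattice_floor R y) *\<^sub>R u (lattice_floor R y) =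
      (\<Sum>x\<in>?A. indicator (?Q x) y *\<^sub>R u x)" for y
  proof -
    have "(\<Sum>x\<in>?A. indicator (?Q x) y *\<^sub>R u x) = (\<Sum>x\<in>?A. if x = lattice_floor R y then u x else 0)"
      by (rule sum.cong) auto
    also have "\<dots> = (if lattice_floor R y \<in> ?A then u (lattice_floor R y) else 0)"
      by (simp add: finite_lattice_ball)
    finally show ?thesis
      using lattice_floor_in_lattice[of R y] by (simp add: indicator_def)
  qed
  then have "(\<integral>y. indicator (ball 0 R) (lattice_floor R y) *\<^sub>R u (lattice_floor R y) \<partial>lborel) =
      (\<integral>y. (\<Sum>x\<in>?A. indicator (?Q x) y *\<^sub>R u x) \<partial>lborel)"
    by simp
  also have "\<dots> = (\<Sum>x\<in>?A. \<integral>y. indicator (?Q x) y *\<^sub>R u x \<partial>lborel)"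
    using Q m by (intro Bochner_Integration.integral_sum integrable_scaleR_left integrable_real_indicator) simp_all
  also have "\<dots> = (\<Sum>x\<in>?A. measure lborel (?Q x) *\<^sub>R u x)"
    using Q m by (intro sum.cong refl) (simp add: integrable_real_indicator)
  also have "\<dots> = (\<Sum>x\<in>?A. u x /\<^sub>R R ^ CARD('n))"
    using m assms by (intro sum.cong) (simp_all add: measure_def divide_inverse)
  finally show ?thesis
    by (simp add: scaleR_sum_right)
qed

text \<open>
  Translations by \<open>h / R\<close> are exactly compatible with the floor because \<open>h\<close> is an integer.
\<close>

lemma lattice_floor_shift:
  assumes "0 < R"
  shows "lattice_floor R (y + axis i (real h / R)) = lattice_floor R y + axis i (real h)"
  using assms by (auto simp: lattice_floor_def vec_eq_iff axis_def distrib_left)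

lemma integral_lborel_translate:
  fixes f :: "'a::euclidean_space \<Rightarrow> 'b :: {banach, second_countable_topology}"
  assumes "f \<in> borel_measurable borel"
  shows "(\<integral>y. f (y + a) \<partial>lborel) = (\<integral>y. f y \<partial>lborel)"
proof -
  have "(\<integral>y. f y \<partial>distr lborel borel ((+) a)) = (\<integral>y. f (a + y) \<partial>lborel)"
    using assms by (intro integral_distr) auto
  then show ?thesis
    by (simp add: lborel_distr_plus add.commute)
qed

lemma lattice_floor_tendsto:
  fixes y :: "real ^ 'n"
  shows "((\<lambda>R. lattice_floor R y /\<^sub>R R) \<longlongrightarrow> y) at_top"
proof (rule vec_tendstoI)
  fix i
  have "((\<lambda>R. of_int \<lfloor>R * y $ i\<rfloor> / R) \<longlongrightarrow> y $ i) at_top"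
  proof (rule real_tendsto_sandwich)
    have "((\<lambda>R::real. y $ i - 1 / R) \<longlongrightarrow> y $ i - 0) at_top"
      by (intro tendsto_intros tendsto_divide_0[OF tendsto_const] filterlim_at_top_imp_at_infinity filterlim_ident)
    then show "((\<lambda>R::real. y $ i - 1 / R) \<longlongrightarrow> y $ i) at_top" by simp
    show "((\<lambda>R. y $ i) \<longlongrightarrow> y $ i) at_top" by simp
    show "\<forall>\<^sub>F R in at_top. y $ i - 1 / R \<le> of_int \<lfloor>R * y $ i\<rfloor> / R"
      using eventually_gt_at_top[of 0]
    proof eventually_elim
      case (elim R)
      have "R * y $ i - 1 \<le> of_int \<lfloor>R * y $ i\<rfloor>" by linarith
      then have "(R * y $ i - 1) / R \<le> of_int \<lfloor>R * y $ i\<rfloor> / R"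
        using elim by (intro divide_right_mono) auto
      then show ?case using elim by (simp add: diff_divide_distrib)
    qed
    show "\<forall>\<^sub>F R in at_top. of_int \<lfloor>R * y $ i\<rfloor> / R \<le> y $ i"
      using eventually_gt_at_top[of 0]
      by eventually_elim (simp add: pos_divide_le_eq mult.commute)
  qed
  then show "((\<lambda>R. (lattice_floor R y /\<^sub>R R) $ i) \<longlongrightarrow> y $ i) at_top"
    by (simp add: lattice_floor_def divide_inverse mult.commute)
qed

text \<open>
  The translates of a bounded part of \<open>S\<close> by \<open>e / (m + 1)\<close> are infinitely many disjoint sets of equal
  measure inside one bounded set, so that measure is 0.
\<close>

lemma null_if_disjoint_translates:
  fixes S :: "'a::euclidean_space set"
  assumes S [measurable]: "S \<in> sets borel"
    and e: "\<And>y t. y \<in> S \<Longrightarrow> t \<noteq> 0 \<Longrightarrow> y + t *\<^sub>R e \<notin> S"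
  shows "S \<in> null_sets lborel"
proof -
  have "S \<inter> ball 0 (real r) \<in> null_sets lborel" for r
  proof -
    define B where "B = S \<inter> ball 0 (real r)"
    have B [measurable]: "B \<in> sets borel" by (simp add: B_def)
    define T where "T m = (+) (- (1 / real (Suc m)) *\<^sub>R e) -` B" for m
    have Tm: "T m \<in> sets borel" for m
      unfolding T_def by (rule measurable_sets_borel[OF _ B]) measurable
    have em: "emeasure lborel (T m) = emeasure lborel B" for m
    proof -
      have "emeasure lborel B = emeasure (distr lborel borel ((+) (- (1 / real (Suc m)) *\<^sub>R e))) B"
        by (simp only: lborel_distr_plus)
      also have "\<dots> = emeasure lborel (T m)"
        by (subst emeasure_distr) (auto simp: T_def)
      finally show ?thesis by simp
    qed
    have "disjoint_family T"
    proof (unfold disjoint_family_on_def, intro ballI impI)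
      fix m l :: nat assume "m \<noteq> l"
      then have "1 / real (Suc m) - 1 / real (Suc l) \<noteq> 0"
        by simp
      then show "T m \<inter> T l = {}"
        using e[of "- (1 / real (Suc m)) *\<^sub>R e + _" "1 / real (Suc m) - 1 / real (Suc l)"]
        by (fastforce simp: T_def B_def algebra_simps)
    qed
    then have "(\<Sum>m. emeasure lborel (T m)) = emeasure lborel (\<Union>m. T m)"
      using Tm by (intro suminf_emeasure) auto
    moreover have "bounded (\<Union>m. T m)"
    proof -
      have "(\<Union>m. T m) \<subseteq> ball 0 (real r + norm e)"
      proof
        fix y assume "y \<in> (\<Union>m. T m)"
        then obtain m where "- (1 / real (Suc m)) *\<^sub>R e + y \<in> B"
          by (auto simp: T_def)
        then have "norm (y - (1 / real (Suc m)) *\<^sub>R e) < r"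
          by (simp add: B_def)
        moreover have "norm ((1 / real (Suc m)) *\<^sub>R e) \<le> norm e"
          by (simp add: divide_le_eq mult_le_cancel_left1)
        ultimately show "y \<in> ball 0 (real r + norm e)"
          using norm_triangle_sub[of y "(1 / real (Suc m)) *\<^sub>R e"] by simp
      qed
      then show ?thesis using bounded_ball bounded_subset by blast
    qed
    then have "emeasure lborel (\<Union>m. T m) \<noteq> \<infinity>"
      using emeasure_bounded_finite[of "\<Union>m. T m"] by auto
    ultimately have "(\<Sum>m::nat. emeasure lborel B) \<noteq> \<infinity>"
      by (simp add: em)
    moreover have "emeasure lborel B = ennreal (measure lborel B)"
      by (intro emeasure_eq_ennreal_measure)
         (use emeasure_bounded_finite[of B] bounded_Int[of S "ball 0 (real r)"] in \<open>auto simp: B_def\<close>)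
    ultimately have "summable (\<lambda>m::nat. measure lborel B)"
      by (intro summable_suminf_not_top) auto
    then have "emeasure lborel B = 0"
      using \<open>emeasure lborel B = ennreal (measure lborel B)\<close> by (simp add: summable_const_iff)
    then show ?thesis
      by (auto simp: B_def[symmetric])
  qed
  then have "(\<Union>r. S \<inter> ball 0 (real r)) \<in> null_sets lborel"
    by (rule null_sets_UN)
  moreover have "(\<Union>r. S \<inter> ball 0 (real r)) = S"
    using reals_Archimedean2 by auto
  ultimately show ?thesis by simp
qed

section \<open>The partial derivatives of the norm\<close>

text \<open>
  The partial derivative of \<open>lp_norm p\<close> in direction \<open>i\<close> off the hyperplane where \<open>x $ i\<close> vanishes. Writing it as a
  power of \<open>\<bar>x $ i\<bar> powr p / (\<Sum>j\<in>UNIV. \<bar>x $ j\<bar> powr p)\<close> shows homogeneity of degree 0 and monotonicity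
  in \<open>x $ i\<close>.
\<close>

definition lp_slope :: "real \<Rightarrow> 'n \<Rightarrow> real ^ 'n \<Rightarrow> real" where
  "lp_slope p i x =
     sgn (x $ i) * (\<bar>x $ i\<bar> powr p / (\<Sum>j\<in>UNIV. \<bar>x $ j\<bar> powr p)) powr ((p - 1) / p)"

lemma lp_sum_split:
  fixes x :: "real ^ 'n"
  shows "(\<Sum>j\<in>UNIV. \<bar>x $ j\<bar> powr p) = \<bar>x $ i\<bar> powr p + (\<Sum>j\<in>-{i}. \<bar>x $ j\<bar> powr p)"
  by (simp add: sum.remove[of UNIV i] Compl_eq_Diff_UNIV)

lemma lp_sum_shift:
  fixes x :: "real ^ 'n"
  shows "(\<Sum>j\<in>UNIV. \<bar>(x + axis i t) $ j\<bar> powr p) =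
    \<bar>x $ i + t\<bar> powr p + (\<Sum>j\<in>-{i}. \<bar>x $ j\<bar> powr p)"
  unfolding lp_sum_split[of _ _ i]
  by (intro arg_cong2[where f = "(+)"] sum.cong) (auto simp: axis_def)

lemma lp_sum_pos:
  fixes x :: "real ^ 'n"
  assumes "x $ j \<noteq> 0"
  shows "0 < (\<Sum>j\<in>UNIV. \<bar>x $ j\<bar> powr p)"
  unfolding lp_sum_split[of _ _ j] using assms by (intro add_pos_nonneg sum_nonneg) auto

lemma lp_norm_has_derivative_axis:
  fixes x :: "real ^ 'n"
  assumes p: "1 < p" and nz: "x $ i + t \<noteq> 0"
  shows "((\<lambda>t. lp_norm p (x + axis i t)) has_real_derivative lp_slope p i (x + axis i t)) (at t)"
proof -
  define a where "a = (\<Sum>j\<in>-{i}. \<bar>x $ j\<bar> powr p)"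
  define u where "u = x $ i + t"
  define S where "S = \<bar>u\<bar> powr p + a"
  have a: "0 \<le> a" unfolding a_def by (intro sum_nonneg) auto
  have u: "u \<noteq> 0" using nz by (simp add: u_def)
  have S: "0 < S" using a u by (simp add: S_def add_pos_nonneg)
  have abs: "((\<lambda>t. \<bar>x $ i + t\<bar>) has_real_derivative sgn u) (at t)"
  proof (rule has_field_derivative_transform_within_open)
    show "((\<lambda>t. sgn u * (x $ i + t)) has_real_derivative sgn u) (at t)"
      by (auto intro!: derivative_eq_intros)
    show "open {t. 0 < sgn u * (x $ i + t)}"
      by (intro open_Collect_less continuous_intros)
    show "t \<in> {t. 0 < sgn u * (x $ i + t)}"
      using nz by (simp add: u_def sgn_if)
    show "sgn u * (x $ i + s) = \<bar>x $ i + s\<bar>" if "s \<in> {t. 0 < sgn u * (x $ i + t)}" for s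
      using that by (cases "0 < u") (auto simp: sgn_if split: if_splits)
  qed
  have "((\<lambda>t. \<bar>x $ i + t\<bar> powr p + a) has_real_derivative p * \<bar>u\<bar> powr (p - 1) * sgn u) (at t)"
    using DERIV_add[OF DERIV_fun_powr[OF abs, of p] DERIV_const[of a]] u
    by (simp add: u_def)
  from DERIV_fun_powr[OF this, of "1 / p"] S
  have "((\<lambda>t. (\<bar>x $ i + t\<bar> powr p + a) powr (1 / p)) has_real_derivative
      1 / p * S powr (1 / p - 1) * (p * \<bar>u\<bar> powr (p - 1) * sgn u)) (at t)"
    by (simp add: S_def u_def)
  also have "1 / p * S powr (1 / p - 1) * (p * \<bar>u\<bar> powr (p - 1) * sgn u) =
      sgn u * (\<bar>u\<bar> powr (p - 1) * S powr (1 / p - 1))"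
    using p by simp
  also have "\<bar>u\<bar> powr (p - 1) * S powr (1 / p - 1) = (\<bar>u\<bar> powr p / S) powr ((p - 1) / p)"
  proof -
    have "(\<bar>u\<bar> powr p / S) powr ((p - 1) / p) = \<bar>u\<bar> powr (p - 1) * S powr (- ((p - 1) / p))"
      using p S by (simp add: powr_divide powr_powr powr_minus_divide)
    also have "- ((p - 1) / p) = 1 / p - 1"
      using p by (simp add: field_simps)
    finally show ?thesis by simp
  qed
  also have "sgn u * (\<bar>u\<bar> powr p / S) powr ((p - 1) / p) = lp_slope p i (x + axis i t)"
    unfolding lp_slope_def lp_sum_shift by (simp add: S_def a_def u_def axis_def)
  finally show ?thesis
    unfolding lp_norm_def lp_sum_shift a_def .
qed

lemma isCont_lp_slope:
  fixes y :: "real ^ 'n"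
  assumes p: "1 < p" and nz: "y $ i \<noteq> 0"
  shows "isCont (lp_slope p i) y"
proof -
  have pow: "((\<lambda>x::real^'n. \<bar>x $ j\<bar> powr p) \<longlongrightarrow> \<bar>y $ j\<bar> powr p) (at y)" for j
    using p by (intro tendsto_powr' tendsto_intros) auto
  have "(\<bar>y $ i\<bar> powr p / (\<Sum>j\<in>UNIV. \<bar>y $ j\<bar> powr p)) > 0"
    using lp_sum_pos[OF nz] nz by simp
  moreover have "(\<Sum>j\<in>UNIV. \<bar>y $ j\<bar> powr p) \<noteq> 0"
    using lp_sum_pos[OF nz, of p] by simp
  ultimately show ?thesis
    unfolding isCont_def lp_slope_def using nz
    by (intro tendsto_intros pow) auto
qed

lemma lp_norm_scaleR:
  assumes "0 \<le> c" "0 < p"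
  shows "lp_norm p (c *\<^sub>R x) = c * lp_norm p x"
proof -
  have "(\<Sum>i\<in>UNIV. \<bar>(c *\<^sub>R x) $ i\<bar> powr p) = c powr p * (\<Sum>i\<in>UNIV. \<bar>x $ i\<bar> powr p)"
    using assms by (simp add: abs_mult powr_mult sum_distrib_left)
  then show ?thesis
    using assms by (simp add: lp_norm_def powr_mult powr_powr sum_nonneg)
qed

lemma norm_axis: "norm (axis i t :: real ^ 'n) = \<bar>t\<bar>"
  using inner_axis_axis[of i t i t] by (simp add: norm_eq_sqrt_inner)

text \<open>
  By homogeneity the increment is \<open>R\<close> times the increment of the norm from \<open>z R / R\<close> over a segment of
  length \<open>h / R\<close>. The mean value theorem turns it into \<open>h\<close> times the slope at some point of that
  segment, and the segment shrinks to \<open>y\<close>, where the slope is continuous.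
\<close>

lemma lp_norm_increment_tendsto:
  fixes y :: "real ^ 'n" and z :: "real \<Rightarrow> real ^ 'n"
  assumes p: "1 < p" and nz: "y $ i \<noteq> 0"
    and z: "((\<lambda>R. z R /\<^sub>R R) \<longlongrightarrow> y) at_top" and h: "0 \<le> h"
  shows "((\<lambda>R. lp_norm p (z R + axis i h) - lp_norm p (z R)) \<longlongrightarrow> h * lp_slope p i y) at_top"
proof (cases "h = 0")
  case True
  have "axis i 0 = (0 :: real ^ 'n)" by (simp add: axis_def vec_eq_iff)
  then show ?thesis unfolding True by (simp only:) simp
next
  case False
  with h have h: "0 < h" by simp
  show ?thesis
  proof (rule tendstoI)
    fix e :: real assume e: "0 < e"
    then have "0 < e / h" using h by simp
    then obtain d0 where d0: "0 < d0"
      and close: "\<And>x. dist x y < d0 \<Longrightarrow> dist (lp_slope p i x) (lp_slope p i y) < e / h"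
      using isCont_lp_slope[OF p nz] unfolding continuous_at_eps_delta by metis
    define d where "d = min d0 \<bar>y $ i\<bar> / 2"
    have d: "0 < d" using d0 nz by (simp add: d_def)
    have "\<forall>\<^sub>F R in at_top. dist (z R /\<^sub>R R) y < d"
      using z d by (rule tendstoD)
    moreover have "\<forall>\<^sub>F R::real in at_top. h / d < R" "\<forall>\<^sub>F R::real in at_top. 0 < R"
      by (rule eventually_gt_at_top)+
    ultimately show "\<forall>\<^sub>F R in at_top.
        dist (lp_norm p (z R + axis i h) - lp_norm p (z R)) (h * lp_slope p i y) < e"
    proof eventually_elim
      case (elim R)
      define x where "x = z R /\<^sub>R R"
      have hR: "0 < h / R" "h / R < d"
        using elim h d by (simp_all add: field_simps)
      have near: "dist (x + axis i t) y < 2 * d" if "0 \<le> t" "t \<le> h / R" for t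
      proof -
        have "dist (x + axis i t) y \<le> dist x y + norm (axis i t)"
          unfolding dist_norm using norm_triangle_ineq[of "x - y" "axis i t"]
          by (simp add: algebra_simps)
        also have "\<dots> < d + d"
          using elim hR that by (intro add_strict_mono) (simp_all add: x_def norm_axis)
        finally show ?thesis by simp
      qed
      have nonzero: "x $ i + t \<noteq> 0" if "0 \<le> t" "t \<le> h / R" for t
      proof
        assume "x $ i + t = 0"
        then have "\<bar>y $ i\<bar> = dist ((x + axis i t) $ i) (y $ i)"
          by (simp add: axis_def dist_real_def)
        also have "\<dots> \<le> dist (x + axis i t) y"
          by (rule dist_vec_nth_le)
        also have "\<dots> < \<bar>y $ i\<bar>"
          using near[OF that] by (simp add: d_def)
        finally show False by simp
      qed
      obtain s where s: "0 < s" "s < h / R"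
        and mvt: "lp_norm p (x + axis i (h / R)) - lp_norm p (x + axis i 0) =
          (h / R - 0) * lp_slope p i (x + axis i s)"
        using MVT2[OF hR(1), of "\<lambda>t. lp_norm p (x + axis i t)" "\<lambda>t. lp_slope p i (x + axis i t)"]
          lp_norm_has_derivative_axis[OF p nonzero] by blast
      have scale: "z R = R *\<^sub>R (x + axis i 0)" "z R + axis i h = R *\<^sub>R (x + axis i (h / R))"
        using elim by (auto simp: x_def vec_eq_iff axis_def distrib_left)
      have "lp_norm p (z R + axis i h) - lp_norm p (z R) =
          R * (lp_norm p (x + axis i (h / R)) - lp_norm p (x + axis i 0))"
        using lp_norm_scaleR[of R p "x + axis i 0"] lp_norm_scaleR[of R p "x + axis i (h / R)"] elim(3) p
        unfolding scale(1)[symmetric] scale(2)[symmetric] by (simp add: right_diff_distrib)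
      also have "\<dots> = h * lp_slope p i (x + axis i s)"
        using elim by (simp only: mvt) simp
      finally have "dist (lp_norm p (z R + axis i h) - lp_norm p (z R)) (h * lp_slope p i y) =
          h * dist (lp_slope p i (x + axis i s)) (lp_slope p i y)"
        using h by (simp add: dist_real_def abs_mult flip: right_diff_distrib)
      also have "\<dots> < h * (e / h)"
        using close[of "x + axis i s"] near[of s] s h
        by (intro mult_strict_left_mono) (auto simp: d_def)
      finally show ?case using h by simp
    qed
  qed
qed

lemma measurable_lp_norm [measurable]: "lp_norm p \<in> borel_measurable borel"
  unfolding lp_norm_def by measurable

lemma measurable_lp_slope [measurable]: "lp_slope p i \<in> borel_measurable borel"
  unfolding lp_slope_def by measurable

text \<open>
  With \<open>a > 0\<close> the contribution of the other coordinates, the slope determines the sign of the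
  coordinate \<open>u\<close> and the ratio \<open>\<bar>u\<bar> powr p / (\<bar>u\<bar> powr p + a)\<close>, hence \<open>u\<close>. For \<open>a = 0\<close> the slope would be
  just a sign, and for \<open>p = 1\<close> the exponent \<open>(p - 1) / p\<close> would vanish: this is the step that needs
  another nonzero coordinate and \<open>p > 1\<close>.
\<close>

lemma lp_slope_inj_on_line:
  fixes y :: "real ^ 'n"
  assumes p: "1 < p" and ij: "i \<noteq> j" and nz: "y $ j \<noteq> 0"
    and eq: "lp_slope p i (y + axis i t) = lp_slope p i y"
  shows "t = 0"
proof -
  define a where "a = (\<Sum>j\<in>-{i}. \<bar>y $ j\<bar> powr p)"
  have a: "0 < a"
    unfolding a_def using ij nz by (intro sum_pos2[of _ j]) auto
  define r where "r v = v powr p / (v powr p + a)" for v :: real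
  define u where "u = y $ i"
  have slope: "lp_slope p i (y + axis i s) = sgn (u + s) * r \<bar>u + s\<bar> powr ((p - 1) / p)" for s
    unfolding lp_slope_def lp_sum_shift by (simp add: r_def a_def u_def axis_def)
  have axis0: "axis i 0 = (0 :: real ^ 'n)" by (simp add: axis_def vec_eq_iff)
  have r_nonneg: "0 \<le> r v" for v
    using a by (simp add: r_def)
  have r_zero: "r v = 0 \<longleftrightarrow> v = 0" for v
  proof -
    have "v powr p + a \<noteq> 0" using a powr_ge_zero[of v p] by linarith
    then show ?thesis by (simp add: r_def)
  qed
  have eq': "sgn (u + t) * r \<bar>u + t\<bar> powr ((p - 1) / p) = sgn u * r \<bar>u\<bar> powr ((p - 1) / p)"
    using eq slope[of t] slope[of 0] by (simp add: axis0)
  have "\<bar>sgn (u + s)\<bar> * r \<bar>u + s\<bar> powr ((p - 1) / p) = r \<bar>u + s\<bar> powr ((p - 1) / p)" for s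
    by (cases "u + s = 0") (simp_all add: r_def)
  from this[of t] this[of 0] arg_cong[OF eq', of abs]
  have "r \<bar>u + t\<bar> powr ((p - 1) / p) = r \<bar>u\<bar> powr ((p - 1) / p)"
    by (simp only: abs_mult abs_of_nonneg powr_ge_zero add_0_right)
  then have "(r \<bar>u + t\<bar> powr ((p - 1) / p)) powr (p / (p - 1)) =
      (r \<bar>u\<bar> powr ((p - 1) / p)) powr (p / (p - 1))"
    by simp
  then have req: "r \<bar>u + t\<bar> = r \<bar>u\<bar>"
    using p r_nonneg by (simp add: powr_powr)
  then have "\<bar>u + t\<bar> powr p * (\<bar>u\<bar> powr p + a) = \<bar>u\<bar> powr p * (\<bar>u + t\<bar> powr p + a)"
    using a powr_ge_zero[of "\<bar>u\<bar>" p] powr_ge_zero[of "\<bar>u + t\<bar>" p]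
    by (simp add: r_def frac_eq_eq add_nonneg_pos[THEN less_imp_neq, symmetric])
  then have "\<bar>u + t\<bar> powr p = \<bar>u\<bar> powr p"
    using a by (simp add: algebra_simps)
  then have "(\<bar>u + t\<bar> powr p) powr (1 / p) = (\<bar>u\<bar> powr p) powr (1 / p)"
    by simp
  then have abs: "\<bar>u + t\<bar> = \<bar>u\<bar>"
    using p by (simp add: powr_powr)
  show "t = 0"
  proof (cases "u = 0")
    case True
    then show ?thesis using abs by simp
  next
    case False
    then have "r \<bar>u\<bar> powr ((p - 1) / p) \<noteq> 0"
      by (simp add: r_zero)
    then have "sgn (u + t) = sgn u"
      using eq' by (simp add: req)
    then show ?thesis
      using abs by (metis add_cancel_left_right mult_sgn_abs)
  qed
qed

lemma AE_coordinate_nonzero: "AE y :: real ^ 'n in lborel. y $ i \<noteq> 0"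
proof (rule AE_I')
  show "{y :: real ^ 'n. y $ i = 0} \<in> null_sets lborel"
  proof (rule null_if_disjoint_translates[of _ "axis i 1"])
    show "{y :: real ^ 'n. y $ i = 0} \<in> sets borel"
      by measurable
  qed (simp add: axis_def)
qed auto

lemma AE_lp_slope_neq:
  fixes i j :: "'n::finite"
  assumes "1 < p" "i \<noteq> j"
  shows "AE y in lborel. lp_slope p i y \<noteq> c"
proof -
  have "{y. lp_slope p i y = c \<and> y $ j \<noteq> 0} \<in> null_sets lborel"
  proof (rule null_if_disjoint_translates[of _ "axis i 1"])
    show "{y. lp_slope p i y = c \<and> y $ j \<noteq> 0} \<in> sets borel"
      by measurable
    fix y :: "real ^ 'n" and t :: real
    assume "y \<in> {y. lp_slope p i y = c \<and> y $ j \<noteq> 0}" "t \<noteq> 0"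
    moreover have "t *\<^sub>R axis i 1 = axis i t"
      by (simp add: axis_def vec_eq_iff)
    ultimately show "y + t *\<^sub>R axis i 1 \<notin> {y. lp_slope p i y = c \<and> y $ j \<noteq> 0}"
      using lp_slope_inj_on_line[OF assms, of y t] by auto
  qed
  then have "AE y in lborel. \<not> (lp_slope p i y = c \<and> y $ j \<noteq> 0)"
    by (rule AE_I') auto
  then show ?thesis
    using AE_coordinate_nonzero[of j] by eventually_elim auto
qed

text \<open>
  The slopes excluded here are the countably many rationals \<open>m / k\<close>.
\<close>

lemma AE_lp_slope_nonresonant:
  fixes i j :: "'n::finite" and k :: int
  assumes "1 < p" "i \<noteq> j" "k \<noteq> 0"
  shows "AE y in lborel. cis (2 * pi * of_int k * lp_slope p i y) \<noteq> 1"
proof -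
  have "AE y in lborel. \<forall>m::int. lp_slope p i y \<noteq> of_int m / of_int k"
    using AE_lp_slope_neq[OF assms(1,2)] by (simp add: AE_all_countable)
  then show ?thesis
  proof eventually_elim
    case (elim y)
    show ?case
    proof
      assume "cis (2 * pi * of_int k * lp_slope p i y) = 1"
      then have "cos (2 * pi * of_int k * lp_slope p i y) = 1"
        by (metis cis.sel(1) one_complex.sel(1))
      then obtain m :: int where "2 * pi * of_int k * lp_slope p i y = of_int m * (2 * pi)"
        by (auto simp: cos_one_2pi_int)
      then have "of_int k * lp_slope p i y = of_int m"
        by (simp add: field_simps)
      then show False
        using elim assms(3) by (simp add: field_simps)
    qed
  qed
qed

section \<open>Exponential sums over the lattice points of a ball\<close>

lemma indicator_ball_tendsto:
  fixes y :: "'a::real_normed_vector"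
  assumes "(g \<longlongrightarrow> y) F" "norm y \<noteq> 1"
  shows "((\<lambda>R. indicator (ball 0 1) (g R) :: real) \<longlongrightarrow> indicator (ball 0 1) y) F"
proof (cases "norm y < 1")
  case True
  then have "\<forall>\<^sub>F R in F. g R \<in> ball 0 1"
    using assms(1) by (intro topological_tendstoD) auto
  then have "\<forall>\<^sub>F R in F. indicator (ball 0 1) (g R) = (indicator (ball 0 1) y :: real)"
    by eventually_elim (use True in simp)
  then show ?thesis by (rule tendsto_eventually)
next
  case False
  then have "\<forall>\<^sub>F R in F. g R \<in> - cball 0 1"
    using assms by (intro topological_tendstoD) auto
  then have "\<forall>\<^sub>F R in F. indicator (ball 0 1) (g R) = (indicator (ball 0 1) y :: real)"
    by eventually_elim (use False in simp)
  then show ?thesis by (rule tendsto_eventually)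
qed

lemma sets_borel_ball [measurable]: "ball c r \<in> sets borel"
  by simp

lemma AE_norm_neq_1: "AE y :: 'a::euclidean_space in lborel. norm y \<noteq> 1"
proof (rule AE_I')
  have "sphere (0::'a) 1 \<in> null_sets lebesgue"
    using negligible_sphere[of "0::'a" 1] by (simp add: negligible_iff_null_sets)
  then show "sphere (0::'a) 1 \<in> null_sets lborel"
    using null_sets_completion_iff[of "sphere (0::'a) 1" lborel] by simp
qed auto

lemma lattice_floor_shift_tendsto:
  "((\<lambda>R. (lattice_floor R y + axis i h) /\<^sub>R R) \<longlongrightarrow> y) at_top"
proof -
  have "((\<lambda>R::real. axis i h /\<^sub>R R) \<longlongrightarrow> 0 *\<^sub>R axis i h) at_top"
    by (intro tendsto_scaleR tendsto_const tendsto_inverse_0_at_top filterlim_ident)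
  then have "((\<lambda>R. lattice_floor R y /\<^sub>R R + axis i h /\<^sub>R R) \<longlongrightarrow> y + 0) at_top"
    by (intro tendsto_add lattice_floor_tendsto) simp
  then show ?thesis by (simp add: scaleR_add_right)
qed

lemma indicator_ball_scale:
  fixes x :: "'a::real_normed_vector"
  assumes "0 < R"
  shows "indicator (ball 0 R) x = indicator (ball 0 1) (x /\<^sub>R R)"
proof -
  have "x \<in> ball 0 R \<longleftrightarrow> x /\<^sub>R R \<in> ball 0 1"
    using assms by (simp add: inverse_eq_divide pos_divide_less_eq)
  then show ?thesis by (simp add: indicator_def)
qed

lemma indicator_lattice_floor_tendsto:
  assumes "norm y \<noteq> 1"
  shows "((\<lambda>R. indicator (ball 0 R) (lattice_floor R y + axis i h) :: real)
    \<longlongrightarrow> indicator (ball 0 1) y) at_top"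
proof (rule Lim_transform_eventually)
  show "((\<lambda>R. indicator (ball 0 1) ((lattice_floor R y + axis i h) /\<^sub>R R) :: real)
      \<longlongrightarrow> indicator (ball 0 1) y) at_top"
    by (intro indicator_ball_tendsto lattice_floor_shift_tendsto assms)
  show "\<forall>\<^sub>F R in at_top. indicator (ball 0 1) ((lattice_floor R y + axis i h) /\<^sub>R R) =
      (indicator (ball 0 R) (lattice_floor R y + axis i h) :: real)"
    using eventually_gt_at_top[of 0] by eventually_elim (rule indicator_ball_scale[symmetric])
qed

text \<open>
  Rounding moves \<open>R y\<close> by at most the dimension, so for \<open>R \<ge> 1\<close> and fixed \<open>h\<close> a single ball dominates all
  the integrands that occur below.
\<close>

lemma indicator_lattice_floor_le:
  fixes y :: "real ^ 'n"
  assumes "1 \<le> R" "0 \<le> h"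
  shows "indicator (ball 0 R) (lattice_floor R y + axis i h)
    \<le> (indicator (ball 0 (1 + real CARD('n) + h)) y :: real)"
proof (cases "lattice_floor R y + axis i h \<in> ball 0 R")
  case True
  have "norm (R *\<^sub>R y - lattice_floor R y) \<le> (\<Sum>i\<in>UNIV. \<bar>(R *\<^sub>R y - lattice_floor R y) $ i\<bar>)"
    by (rule norm_le_l1_cart)
  also have "\<dots> \<le> (\<Sum>i\<in>(UNIV::'n set). 1)"
  proof (rule sum_mono)
    fix i :: 'n
    show "\<bar>(R *\<^sub>R y - lattice_floor R y) $ i\<bar> \<le> 1"
      unfolding lattice_floor_def abs_le_iff
      using floor_correct[of "R * y $ i"] by simp linarith
  qed
  finally have "norm (R *\<^sub>R y - lattice_floor R y) \<le> CARD('n)" by simp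
  moreover have "norm (lattice_floor R y) \<le> norm (lattice_floor R y + axis i h) + h"
    using norm_triangle_ineq4[of "lattice_floor R y + axis i h" "axis i h"] assms
    by (simp add: norm_axis)
  ultimately have "norm (R *\<^sub>R y) < R + CARD('n) + h"
    using True norm_triangle_sub[of "R *\<^sub>R y" "lattice_floor R y"] by simp
  also have "\<dots> \<le> R * (1 + real CARD('n) + h)"
    using assms mult_right_mono[of 1 R "real CARD('n) + h"] by (simp add: algebra_simps)
  finally have "norm y < 1 + CARD('n) + h"
    using assms by simp
  then show ?thesis by simp
qed simp

lemma integrable_indicator_ball: "integrable lborel (indicator (ball (0::'a::euclidean_space) r) :: 'a \<Rightarrow> real)"
  using emeasure_bounded_finite[of "ball (0::'a) r"] by (intro integrable_real_indicator) auto

text \<open>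
  Dominated convergence for the indicator of the ball; its boundary, the unit sphere, is null.
\<close>

lemma card_lattice_ball_tendsto:
  "((\<lambda>R. card (integer_lattice \<inter> ball (0 :: real ^ 'n) R) / R ^ CARD('n))
    \<longlongrightarrow> measure lborel (ball (0 :: real ^ 'n) 1)) at_top"
proof (rule Lim_transform_eventually)
  fix i :: 'n
  have ax: "axis i 0 = (0 :: real ^ 'n)" by (simp add: axis_def vec_eq_iff)
  have "((\<lambda>R. \<integral>y. indicator (ball 0 R) (lattice_floor R y :: real ^ 'n) \<partial>lborel)
      \<longlongrightarrow> (\<integral>y. indicator (ball (0 :: real ^ 'n) 1) y \<partial>lborel :: real)) at_top"
  proof (rule integral_dominated_convergence_at_top)
    show "integrable lborel (indicator (ball (0 :: real ^ 'n) (1 + real CARD('n) + 0)) :: _ \<Rightarrow> real)"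
      by (rule integrable_indicator_ball)
    show "AE y :: real ^ 'n in lborel. ((\<lambda>R. indicator (ball 0 R) (lattice_floor R y) :: real)
        \<longlongrightarrow> indicator (ball 0 1) y) at_top"
      using AE_norm_neq_1
      by eventually_elim (use indicator_lattice_floor_tendsto[of _ i 0] in \<open>simp add: ax\<close>)
    show "\<forall>\<^sub>F R in at_top. AE y :: real ^ 'n in lborel.
        norm (indicator (ball 0 R) (lattice_floor R y) :: real)
          \<le> indicator (ball 0 (1 + real CARD('n) + 0)) y"
      using eventually_ge_at_top[of 1]
      by eventually_elim (use indicator_lattice_floor_le[of _ 0 _ i] in \<open>auto simp: ax\<close>)
  qed measurable
  then show "((\<lambda>R. \<integral>y. indicator (ball 0 R) (lattice_floor R y :: real ^ 'n) \<partial>lborel :: real)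
      \<longlongrightarrow> measure lborel (ball (0 :: real ^ 'n) 1)) at_top"
    by simp
  show "\<forall>\<^sub>F R in at_top. (\<integral>y. indicator (ball 0 R) (lattice_floor R y :: real ^ 'n) \<partial>lborel) =
      card (integer_lattice \<inter> ball (0 :: real ^ 'n) R) / R ^ CARD('n)"
    using eventually_gt_at_top[of 0]
  proof eventually_elim
    case (elim R)
    show ?case
      using integral_lattice_floor[OF elim, of "\<lambda>_ :: real ^ 'n. 1 :: real"]
      by (simp add: divide_inverse mult.commute)
  qed
qed

lemma geometric_average_tendsto_0:
  fixes w :: complex
  assumes "norm w = 1" "w \<noteq> 1"
  shows "(\<lambda>H. norm (\<Sum>h<H. w ^ h) / real H) \<longlonglongrightarrow> 0"
proof (rule tendsto_sandwich)
  show "(\<lambda>H. 0 :: real) \<longlonglongrightarrow> 0"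
    by simp
  show "(\<lambda>H. (2 / norm (w - 1)) / real H) \<longlonglongrightarrow> 0"
    by (rule lim_const_over_n)
  show "\<forall>\<^sub>F H in sequentially. norm (\<Sum>h<H. w ^ h) / real H \<le> (2 / norm (w - 1)) / real H"
  proof (intro always_eventually allI divide_right_mono)
    fix H
    have "norm (w ^ H - 1) \<le> 2"
      using norm_triangle_ineq4[of "w ^ H" 1] assms by (simp add: norm_power)
    then show "norm (\<Sum>h<H. w ^ h) \<le> 2 / norm (w - 1)"
      using assms by (simp add: geometric_sum norm_divide divide_right_mono)
  qed simp
qed auto

text \<open>
  The averaging argument: shift invariance gives the bound by averages over \<open>H\<close> consecutive lattice
  points, then \<open>R \<rightarrow> \<infinity>\<close> with \<open>H\<close> fixed, and finally \<open>H \<rightarrow> \<infinity>\<close>.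
\<close>

lemma lattice_exponential_sum_tendsto_0:
  fixes k :: int
  assumes n: "CARD('n::finite) \<ge> 2" and p: "1 < p" and k: "k \<noteq> 0"
  shows "((\<lambda>R. (\<Sum>x\<in>integer_lattice \<inter> ball (0 :: real ^ 'n) R. mod_one (lp_norm p x) powi k) /\<^sub>R
    R ^ CARD('n)) \<longlongrightarrow> 0) at_top"
proof -
  obtain i j :: 'n where ij: "i \<noteq> j"
    using ex_card[OF n] by (auto simp: card_2_iff)
  define u where "u x = cis (2 * pi * of_int k * lp_norm p x)" for x :: "real ^ 'n"
  have u_eq: "mod_one (lp_norm p x) powi k = u x" for x :: "real ^ 'n"
    by (simp add: mod_one_def u_def cis_power_int mult_ac)
  have [measurable]: "u \<in> borel_measurable borel"
    unfolding u_def
    by (rule measurable_compose[OF _ borel_measurable_continuous_onI[of cis]])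
       (auto intro!: continuous_intros)
  \<comment> \<open>The limiting rotation along direction \<open>i\<close> at \<open>y\<close>.\<close>
  define w where "w y = cis (2 * pi * of_int k * lp_slope p i y)" for y :: "real ^ 'n"
  have [measurable]: "w \<in> borel_measurable borel"
    unfolding w_def
    by (rule measurable_compose[OF _ borel_measurable_continuous_onI[of cis]])
       (auto intro!: continuous_intros)
  \<comment> \<open>The summand at the lattice point of \<open>y\<close> moved by \<open>h\<close> steps; it vanishes when the moved point
    leaves the ball, so shifting produces no boundary terms.\<close>
  define F where "F h R y = (indicator (ball 0 R) (lattice_floor R y + axis i (real h)) :: real) *\<^sub>R
      u (lattice_floor R y + axis i (real h))" for h R and y :: "real ^ 'n"
  have [measurable]: "F h R \<in> borel_measurable borel" for h R
    unfolding F_def by measurable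
  have ax: "axis i 0 = (0 :: real ^ 'n)" by (simp add: axis_def vec_eq_iff)
  define I where "I R = (\<integral>y. F 0 R y \<partial>lborel)" for R
  have I_eq: "(\<Sum>x\<in>integer_lattice \<inter> ball (0 :: real ^ 'n) R. mod_one (lp_norm p x) powi k) /\<^sub>R
      R ^ CARD('n) = I R" if "0 < R" for R
    using integral_lattice_floor[OF that, of u] by (simp add: I_def F_def ax u_eq)
  have norm_F: "norm (F h R y) = indicator (ball 0 R) (lattice_floor R y + axis i (real h))" for h R y
    by (simp add: F_def u_def)
  define r where "r H = 1 + real CARD('n) + real H" for H
  have norm_F_le: "norm (F h R y) \<le> indicator (ball 0 (r H)) y" if "1 \<le> R" "h \<le> H" for h H R y
  proof -
    have "norm (F h R y) \<le> indicator (ball 0 (r h)) y"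
      using indicator_lattice_floor_le[OF that(1), of "real h" y i] by (simp add: norm_F r_def)
    also have "\<dots> \<le> indicator (ball 0 (r H)) y"
      using that by (auto simp: indicator_def r_def)
    finally show ?thesis .
  qed
  have int_F: "integrable lborel (F h R)" if "1 \<le> R" for h R
    by (rule Bochner_Integration.integrable_bound[OF integrable_indicator_ball[of "r h"]])
       (use norm_F_le[OF that, of h h] in auto)
  have I_shift: "I R = (\<integral>y. F h R y \<partial>lborel)" if "0 < R" for h R
  proof -
    have "I R = (\<integral>y. F 0 R (y + axis i (real h / R)) \<partial>lborel)"
      unfolding I_def by (rule integral_lborel_translate[symmetric]) simp
    also have "\<dots> = (\<integral>y. F h R y \<partial>lborel)"
      by (simp add: F_def lattice_floor_shift[OF that] ax)
    finally show ?thesis .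
  qed
  define \<psi> where "\<psi> H R y = norm (\<Sum>h<H. F h R y) / real H" for H R y
  have [measurable]: "\<psi> H R \<in> borel_measurable borel" for H R
    unfolding \<psi>_def by measurable
  have I_le: "norm (I R) \<le> (\<integral>y. \<psi> H R y \<partial>lborel)" if "1 \<le> R" "0 < H" for H R
  proof -
    have "real H * norm (I R) = norm (\<Sum>h<H. \<integral>y. F h R y \<partial>lborel)"
      using I_shift[of R] that by (simp add: norm_mult)
    also have "\<dots> = norm (\<integral>y. (\<Sum>h<H. F h R y) \<partial>lborel)"
      using int_F[OF that(1)] by simp
    also have "\<dots> \<le> (\<integral>y. norm (\<Sum>h<H. F h R y) \<partial>lborel)"
      by (rule integral_norm_bound)
    also have "\<dots> = real H * (\<integral>y. \<psi> H R y \<partial>lborel)"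
      using that by (simp add: \<psi>_def)
    finally show ?thesis
      using that by simp
  qed
  define g where "g H y = norm (\<Sum>h<H. (indicator (ball 0 1) y :: real) *\<^sub>R w y ^ h) / real H" for H y
  have [measurable]: "g H \<in> borel_measurable borel" for H
    unfolding g_def by measurable
  have psi_lim: "((\<lambda>R. \<integral>y. \<psi> H R y \<partial>lborel) \<longlongrightarrow> (\<integral>y. g H y \<partial>lborel)) at_top"
    if "0 < H" for H
  proof (rule integral_dominated_convergence_at_top)
    show "integrable lborel (indicator (ball (0 :: real ^ 'n) (r H)) :: _ \<Rightarrow> real)"
      by (rule integrable_indicator_ball)
    show "\<forall>\<^sub>F R in at_top. AE y in lborel. norm (\<psi> H R y) \<le> indicator (ball 0 (r H)) y"
      using eventually_ge_at_top[of 1]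
    proof eventually_elim
      case (elim R)
      have "norm (\<psi> H R y) \<le> indicator (ball 0 (r H)) y" for y
      proof -
        have "norm (\<Sum>h<H. F h R y) \<le> (\<Sum>h<H. indicator (ball 0 (r H)) y)"
          by (rule sum_norm_le) (use norm_F_le[OF elim] in simp)
        then show ?thesis
          by (cases "H = 0") (simp_all add: \<psi>_def field_simps)
      qed
      then show ?case by simp
    qed
    show "AE y in lborel. ((\<lambda>R. \<psi> H R y) \<longlongrightarrow> g H y) at_top"
      using AE_norm_neq_1 AE_coordinate_nonzero[of i]
    proof eventually_elim
      case (elim y)
      have ratio: "((\<lambda>R. u (lattice_floor R y + axis i (real h)) / u (lattice_floor R y))
          \<longlongrightarrow> w y ^ h) at_top" for h
      proof -
        have "((\<lambda>R. cis (2 * pi * of_int k *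
              (lp_norm p (lattice_floor R y + axis i (real h)) - lp_norm p (lattice_floor R y))))
            \<longlongrightarrow> cis (2 * pi * of_int k * (real h * lp_slope p i y))) at_top"
          using elim by (intro tendsto_cis tendsto_mult tendsto_const
              lp_norm_increment_tendsto[OF p] lattice_floor_tendsto) auto
        moreover have "w y ^ h = cis (2 * pi * of_int k * (real h * lp_slope p i y))"
          unfolding w_def Complex.DeMoivre by (simp only: mult_ac)
        ultimately show ?thesis
          by (simp add: u_def cis_divide right_diff_distrib)
      qed
      \<comment> \<open>Dividing by the unimodular phase at the starting point leaves only phase differences, and
        these converge.\<close>
      have "\<psi> H R y = norm (\<Sum>h<H. (indicator (ball 0 R) (lattice_floor R y + axis i (real h)) :: real) *\<^sub>R
          (u (lattice_floor R y + axis i (real h)) / u (lattice_floor R y))) / real H" for R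
      proof -
        have "(\<Sum>h<H. (indicator (ball 0 R) (lattice_floor R y + axis i (real h)) :: real) *\<^sub>R
            (u (lattice_floor R y + axis i (real h)) / u (lattice_floor R y))) =
            (\<Sum>h<H. F h R y) / u (lattice_floor R y)"
          by (simp add: F_def sum_divide_distrib)
        then show ?thesis
          by (simp add: \<psi>_def norm_divide u_def)
      qed
      then show ?case
        unfolding g_def using elim that
        by (simp only:) (intro tendsto_intros ratio indicator_lattice_floor_tendsto; simp)
    qed
  qed measurable
  have g_lim: "(\<lambda>H. \<integral>y. g H y \<partial>lborel) \<longlonglongrightarrow> integral\<^sup>L lborel (\<lambda>y :: real ^ 'n. 0 :: real)"
  proof (rule integral_dominated_convergence)
    show "integrable lborel (indicator (ball (0 :: real ^ 'n) 1) :: _ \<Rightarrow> real)"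
      by (rule integrable_indicator_ball)
    have norm_w: "norm (w y) = 1" for y
      by (simp add: w_def)
    have g_eq: "g H y = indicator (ball 0 1) y * (norm (\<Sum>h<H. w y ^ h) / real H)" for H y
      by (simp add: g_def flip: scaleR_sum_right)
    show "AE y in lborel. norm (g H y) \<le> indicator (ball 0 1) y" for H
    proof (rule AE_I2)
      fix y
      have "norm (\<Sum>h<H. w y ^ h) \<le> (\<Sum>h<H. 1)"
        by (rule sum_norm_le) (simp add: norm_power norm_w)
      then have "norm (\<Sum>h<H. w y ^ h) / real H \<le> 1"
        by (cases "H = 0") simp_all
      then show "norm (g H y) \<le> indicator (ball 0 1) y"
        by (simp add: g_eq indicator_def)
    qed
    show "AE y in lborel. (\<lambda>H. g H y) \<longlonglongrightarrow> 0"
      using AE_lp_slope_nonresonant[OF p ij k]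
    proof eventually_elim
      case (elim y)
      then show ?case
        unfolding g_eq
        by (intro tendsto_mult_right_zero geometric_average_tendsto_0) (simp_all add: norm_w w_def)
    qed
  qed measurable
  have "(I \<longlongrightarrow> 0) at_top"
  proof (rule tendstoI)
    fix e :: real assume e: "0 < e"
    have "\<forall>\<^sub>F H in sequentially. (\<integral>y. g H y \<partial>lborel) < e"
      using order_tendstoD(2)[OF g_lim] e by simp
    then have "\<forall>\<^sub>F H in sequentially. (\<integral>y. g H y \<partial>lborel) < e \<and> 0 < H"
      using eventually_gt_at_top[of 0] by eventually_elim simp
    then obtain H where H: "(\<integral>y. g H y \<partial>lborel) < e" "0 < H"
      using eventually_happens[of _ sequentially] trivial_limit_sequentially by blast
    have "\<forall>\<^sub>F R in at_top. (\<integral>y. \<psi> H R y \<partial>lborel) < e"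
      by (rule order_tendstoD(2)[OF psi_lim[OF H(2)] H(1)])
    then show "\<forall>\<^sub>F R in at_top. dist (I R) 0 < e"
      using eventually_ge_at_top[of 1]
    proof eventually_elim
      case (elim R)
      then show ?case
        unfolding dist_0_norm dist_commute[of _ 0] using I_le[OF elim(2) H(2)] by linarith
    qed
  qed
  moreover have "\<forall>\<^sub>F R in at_top. I R =
      (\<Sum>x\<in>integer_lattice \<inter> ball (0 :: real ^ 'n) R. mod_one (lp_norm p x) powi k) /\<^sub>R R ^ CARD('n)"
    using eventually_gt_at_top[of 0] by eventually_elim (simp add: I_eq)
  ultimately show ?thesis
    by (rule Lim_transform_eventually)
qed

theorem corollary1p5:
  fixes p :: real
  assumes "CARD('n::finite) \<ge> 2" and "1 < p"
  shows "equidistributed_mod_one (integer_lattice :: (real ^ 'n) set) UNIV (lp_norm p)"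
  unfolding equidistributed_mod_one_def
proof (rule weyl_criterion_circle)
  let ?A = "\<lambda>R. integer_lattice \<inter> ball (0 :: real ^ 'n) R"
  let ?M = "\<lambda>R. counting_ball (integer_lattice :: (real ^ 'n) set) UNIV R"
  have meas: "mod_one \<circ> lp_norm p \<in> ?M R \<rightarrow>\<^sub>M circle_borel" for R
    using mod_one_in_circle
    by (simp add: counting_ball_def uniform_count_measure_def measurable_point_measure_eq1
        finite_lattice_ball space_restrict_space del: mem_sphere)
  show "sets (distr (?M R) circle_borel (mod_one \<circ> lp_norm p)) = sets circle_borel" for R
    by simp
  have "0 \<in> ?A R" if "0 < R" for R
    using that by (simp add: integer_lattice_def)
  then have prob: "prob_space (?M R)" if "0 < R" for R
    using that unfolding counting_ball_def Int_UNIV_right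
    by (intro prob_space_uniform_count_measure finite_lattice_ball) blast
  show "\<forall>\<^sub>F R in at_top. prob_space (distr (?M R) circle_borel (mod_one \<circ> lp_norm p))"
    using eventually_gt_at_top[of 0] by eventually_elim (intro prob_space.prob_space_distr prob meas)
  fix k :: int assume k: "k \<noteq> 0"
  have integral: "(\<integral>z. z powi k \<partial>distr (?M R) circle_borel (mod_one \<circ> lp_norm p)) =
      (\<Sum>x\<in>?A R. mod_one (lp_norm p x) powi k) /\<^sub>R card (?A R)" for R
  proof -
    have "(\<integral>z. z powi k \<partial>distr (?M R) circle_borel (mod_one \<circ> lp_norm p)) =
        (\<integral>x. mod_one (lp_norm p x) powi k \<partial>?M R)"
      by (subst integral_distr[OF meas])
         (simp_all add: measurable_circle_continuous continuous_on_powi_circle)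
    also have "\<dots> = (\<Sum>x\<in>?A R. mod_one (lp_norm p x) powi k) /\<^sub>R card (?A R)"
      unfolding counting_ball_def uniform_count_measure_def
      by (subst lebesgue_integral_point_measure_finite)
         (simp_all add: finite_lattice_ball scaleR_sum_right divide_inverse)
    finally show ?thesis .
  qed
  have "((\<lambda>R. inverse (card (?A R) / R ^ CARD('n)) *\<^sub>R
      ((\<Sum>x\<in>?A R. mod_one (lp_norm p x) powi k) /\<^sub>R R ^ CARD('n))) \<longlongrightarrow>
      inverse (measure lborel (ball (0 :: real ^ 'n) 1)) *\<^sub>R 0) at_top"
  proof (intro tendsto_intros card_lattice_ball_tendsto lattice_exponential_sum_tendsto_0 assms k)
    show "measure lborel (ball (0 :: real ^ 'n) 1) \<noteq> 0"
      using content_ball_pos[of 1 "0 :: real ^ 'n"] by simp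
  qed
  then have "((\<lambda>R. inverse (card (?A R) / R ^ CARD('n)) *\<^sub>R
      ((\<Sum>x\<in>?A R. mod_one (lp_norm p x) powi k) /\<^sub>R R ^ CARD('n))) \<longlongrightarrow> 0) at_top"
    by simp
  then show "((\<lambda>R. \<integral>z. z powi k \<partial>distr (?M R) circle_borel (mod_one \<circ> lp_norm p)) \<longlongrightarrow> 0) at_top"
    unfolding integral
    by (rule Lim_transform_eventually)
       (use eventually_gt_at_top[of 0] in \<open>eventually_elim, simp add: field_simps\<close>)
qed

end
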